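(* Let $G$ be a connected simple graph of diameter at least $3$. Then for every integer $s\geqslant 1$ the $s$-jet graph $\mathcal{J}_s(G)$ is not co-chordal.
   Context: For a simple graph $G$ with vertex set $\{x_1,\dots,x_n\}$ and $s\in\mathbb{N}$, the $s$-jet graph $\mathcal{J}_s(G)$ is the simple graph with vertex set $\{x_{i,j}\mid i=1,\dots,n,\ j=0,\dots,s\}$ in which $\{x_{i,j},x_{k,l}\}$ is an edge if and only if $\{x_i,x_k\}$ is an edge of $G$ and $j+l\leqslant s$. A graph is chordal if it has no induced cycle of length four or more; a graph is co-chordal if its complement is chordal. *)

theory Defs
  imports "Graph_Theory.Graph_Theory"
begin

text \<open>
  A finite simple graph is a \<^locale>\<open>pair_graph\<close>: a finite, symmetric, loop-free relation on a finite
  vertex set, the edge \<open>{u, v}\<close> being represented by the two arcs \<open>(u, v)\<close> and \<open>(v, u)\<close>.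
\<close>

definition jet_graph :: "nat \<Rightarrow> 'a pair_pre_digraph \<Rightarrow> ('a \<times> nat) pair_pre_digraph" where
  "jet_graph s G =
     \<lparr> pverts = pverts G \<times> {0..s},
       parcs = {((x, j), (y, l)) | x j y l. (x, y) \<in> parcs G \<and> j + l \<le> s} \<rparr>"

definition complement_graph :: "'a pair_pre_digraph \<Rightarrow> 'a pair_pre_digraph" where
  "complement_graph G =
     \<lparr> pverts = pverts G,
       parcs = {(u, v). u \<in> pverts G \<and> v \<in> pverts G \<and> u \<noteq> v \<and> (u, v) \<notin> parcs G} \<rparr>"

text \<open>
  The cycle \<open>p\<close> is a list of arcs traversed in one direction, so the edges of the undirected cycle are
  \<open>set p\<close> together with its converse, and \<open>fst ` set p\<close> is its vertex set. The library notion of cycle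
  admits \<open>a, b, a\<close>; on simple graphs it is the undirected notion from length three on.
\<close>

definition induced_cycle :: "'a pair_pre_digraph \<Rightarrow> ('a \<times> 'a) awalk \<Rightarrow> bool" where
  "induced_cycle G p \<longleftrightarrow>
     pre_digraph.cycle (with_proj G) p \<and>
     arcs (with_proj G \<restriction> (fst ` set p)) = set p \<union> (set p)\<inverse>"

definition chordal :: "'a pair_pre_digraph \<Rightarrow> bool" where
  "chordal G \<longleftrightarrow> \<not> (\<exists>p. induced_cycle G p \<and> length p \<ge> 4)"

definition co_chordal :: "'a pair_pre_digraph \<Rightarrow> bool" where
  "co_chordal G \<longleftrightarrow> chordal (complement_graph G)"

text \<open>With unit weights the shortest-path cost is the number of edges of a shortest walk.\<close>

definition graph_dist :: "'a pair_pre_digraph \<Rightarrow> 'a \<Rightarrow> 'a \<Rightarrow> ereal" where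
  "graph_dist G u v = wf_digraph.\<mu> (with_proj G) (\<lambda>_. 1) u v"

definition graph_diameter :: "'a pair_pre_digraph \<Rightarrow> ereal" where
  "graph_diameter G = (SUP u\<in>pverts G. SUP v\<in>pverts G. graph_dist G u v)"

lemma pair_graph_complement_graph:
  assumes "pair_graph G"
  shows "pair_graph (complement_graph G)"
proof -
  interpret pair_graph G by fact
  have "finite (parcs (complement_graph G))"
    by (rule finite_subset[of _ "pverts G \<times> pverts G"])
       (auto simp: complement_graph_def pair_finite_verts)
  then show ?thesis
    using pair_finite_verts pair_sym_arcs
    by unfold_locales (auto simp: complement_graph_def symmetric_def sym_def)
qed

lemma pair_graph_jet_graph:
  assumes "pair_graph G"
  shows "pair_graph (jet_graph s G)"
proof -
  interpret pair_graph G by fact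
  have "finite (parcs (jet_graph s G))"
    by (rule finite_subset[of _ "(pverts G \<times> {0..s}) \<times> (pverts G \<times> {0..s})"])
       (auto simp: jet_graph_def pair_finite_verts dest: in_arcsD1 in_arcsD2)
  then show ?thesis
    using pair_finite_verts pair_sym_arcs
    by unfold_locales
       (auto simp: jet_graph_def symmetric_def sym_def add.commute
             dest: in_arcsD1 in_arcsD2 no_loops')
qed

end

theory Submission
  imports Defs
begin

text \<open>
  Choose \<open>u\<close>, \<open>v\<close> at distance at least three, a neighbour \<open>b\<close> of \<open>u\<close> and a neighbour \<open>c\<close> of \<open>v\<close>. The
  vertices \<open>b\<close> and \<open>c\<close> may be adjacent in the graph, but \<open>(b, s)\<close> and \<open>(c, s)\<close> are not adjacent in the
  jet graph because \<open>s + s > s\<close>. Hence the edges from \<open>(u, 0)\<close> to \<open>(b, s)\<close> and from \<open>(v, 0)\<close> to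
  \<open>(c, s)\<close> form an induced matching, which is an induced four-cycle in the complement.
\<close>

text \<open>In the complement, \<open>{a, b}\<close> and \<open>{c, d}\<close> are the sides of an
  induced \<open>K_{2,2}\<close>, which is a chordless four-cycle.\<close>

lemma not_co_chordal_if_induced_two_edges:
  assumes "pair_graph G"
    and ab: "(a, b) \<in> parcs G" and cd: "(c, d) \<in> parcs G"
    and "(a, c) \<notin> parcs G" "(a, d) \<notin> parcs G" "(b, c) \<notin> parcs G" "(b, d) \<notin> parcs G"
  shows "\<not> co_chordal G"
proof -
  interpret pair_graph G by fact
  interpret C: pair_graph "complement_graph G"
    using assms(1) by (rule pair_graph_complement_graph)
  have sym: "(y, x) \<in> parcs G" if "(x, y) \<in> parcs G" for x y
    using that pair_sym_arcs by (auto simp: symmetric_def sym_def)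
  have irrefl: "(x, x) \<notin> parcs G" for x
    using no_loops' by blast
  have verts: "a \<in> pverts G" "b \<in> pverts G" "c \<in> pverts G" "d \<in> pverts G"
    using ab cd by (auto dest: in_arcsD1 in_arcsD2)
  have nonarcs: "(c, a) \<notin> parcs G" "(d, a) \<notin> parcs G" "(c, b) \<notin> parcs G" "(d, b) \<notin> parcs G"
    using assms(4-) sym by blast+
  \<comment> \<open>Identifying an end of one edge with an end of the other would turn a given edge
    into an excluded cross pair.\<close>
  have distinct: "a \<noteq> b" "c \<noteq> d" "a \<noteq> c" "a \<noteq> d" "b \<noteq> c" "b \<noteq> d"
    using assms sym irrefl by blast+
  \<comment> \<open>The cycle alternates between the two edges, so its diagonals \<open>a b\<close>
    and \<open>c d\<close> are edges of \<open>G\<close>.\<close>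
  define p where "p = [(a, c), (c, b), (b, d), (d, a)]"
  have "set p \<subseteq> parcs (complement_graph G)" "a \<in> pverts (complement_graph G)"
    using assms(4-) verts nonarcs distinct by (auto simp: p_def complement_graph_def)
  then have "C.awalk a p a"
    by (simp add: p_def C.awalk_Cons_iff C.awalk_Nil_iff)
  then have "C.cycle p"
    unfolding C.cycle_def using distinct by (intro exI[of _ a]) (auto simp: p_def)
  moreover have "arcs (with_proj (complement_graph G) \<restriction> (fst ` set p)) = set p \<union> (set p)\<inverse>"
  proof (rule set_eqI, clarify)
    fix x y
    have "(x, y) \<in> arcs (with_proj (complement_graph G) \<restriction> (fst ` set p)) \<longleftrightarrow>
        x \<in> {a, b, c, d} \<and> y \<in> {a, b, c, d} \<and> x \<noteq> y \<and> (x, y) \<notin> parcs G"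
      using verts by (auto simp: p_def complement_graph_def)
    also have "\<dots> \<longleftrightarrow> x \<in> {a, b} \<and> y \<in> {c, d} \<or> x \<in> {c, d} \<and> y \<in> {a, b}"
      using ab cd sym[OF ab] sym[OF cd] assms(4-) nonarcs distinct by blast
    also have "\<dots> \<longleftrightarrow> (x, y) \<in> set p \<union> (set p)\<inverse>"
      unfolding p_def by simp blast
    finally show "(x, y) \<in> arcs (with_proj (complement_graph G) \<restriction> (fst ` set p)) \<longleftrightarrow>
        (x, y) \<in> set p \<union> (set p)\<inverse>" .
  qed
  ultimately have "induced_cycle (complement_graph G) p"
    by (simp add: induced_cycle_def)
  moreover have "length p \<ge> 4"
    by (simp add: p_def)
  ultimately show ?thesis
    unfolding co_chordal_def chordal_def by blast
qed

text \<open>If every pair were joined by a walk of at most \<open>n\<close> arcs, the supremum would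
  be at most \<open>n\<close>. A pair joined by no walk qualifies vacuously.\<close>

lemma far_pair_if_diameter_ge:
  fixes n :: nat
  assumes "pair_graph G" and diam: "graph_diameter G \<ge> ereal (real (Suc n))"
  obtains (far_pair) u v where "u \<in> pverts G" "v \<in> pverts G"
    "\<And>p. pre_digraph.awalk (with_proj G) u p v \<Longrightarrow> length p > n"
proof (rule ccontr)
  interpret pair_graph G by fact
  assume no_thesis: "\<not> thesis"
  have short: "\<exists>p. awalk u p v \<and> length p \<le> n" if uv: "u \<in> pverts G" "v \<in> pverts G" for u v
  proof (rule ccontr)
    assume "\<nexists>p. awalk u p v \<and> length p \<le> n"
    then have "length p > n" if "awalk u p v" for p
      using that by (simp add: not_le)
    from far_pair[OF uv this] no_thesis show False
      by simp
  qed
  have "graph_diameter G \<le> ereal (real n)"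
    unfolding graph_diameter_def
  proof (intro SUP_least)
    fix u v assume "u \<in> pverts G" "v \<in> pverts G"
    then obtain p where p: "awalk u p v" "length p \<le> n"
      using short by blast
    have "graph_dist G u v \<le> ereal (awalk_cost (\<lambda>_. 1) p)"
      unfolding graph_dist_def using p(1) by (rule min_cost_le_walk_cost)
    also have "\<dots> \<le> ereal (real n)"
      using p(2) by (simp add: awalk_cost_def sum_list_triv)
    finally show "graph_dist G u v \<le> ereal (real n)" .
  qed
  with diam have "ereal (real (Suc n)) \<le> ereal (real n)"
    by (rule order_trans)
  then show False
    by simp
qed

theorem theorem3:
  fixes G :: "'a pair_pre_digraph" and s :: nat
  assumes "pair_graph G"
    and "Digraph_Component.connected (with_proj G)"
    and "graph_diameter G \<ge> 3"
    and "s \<ge> 1"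
  shows "\<not> co_chordal (jet_graph s G)"
proof -
  interpret pair_graph G by fact
  have sym: "(y, x) \<in> parcs G" if "(x, y) \<in> parcs G" for x y
    using that pair_sym_arcs by (auto simp: symmetric_def sym_def)
  have "graph_diameter G \<ge> ereal (real (Suc 2))"
    using assms(3) by simp
  with assms(1) obtain u v where uv: "u \<in> pverts G" "v \<in> pverts G"
    and far: "\<And>p. awalk u p v \<Longrightarrow> length p > 2"
    by (rule far_pair_if_diameter_ge) blast
  \<comment> \<open>Connectedness speaks of the symmetric closure; \<open>G\<close> is symmetric, so
    the walk lies in \<open>G\<close>. Its first arc supplies \<open>b\<close>, its last arc
    \<open>c\<close>.\<close>
  obtain p' where "pre_digraph.awalk (mk_symmetric G) u p' v"
    by (rule connected_awalkE[OF assms(2), of u v]) (use uv in auto)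
  then obtain p where p: "awalk u p v"
    by (rule mk_symmetric_awalk_imp_awalk[OF sym_arcs])
  with far have "p \<noteq> []"
    by fastforce
  then obtain b q where "p = (u, b) # q"
    using p by (cases p) (auto simp: awalk_Cons_iff)
  with p have ub: "(u, b) \<in> parcs G"
    by (simp add: awalk_Cons_iff)
  obtain c r where "p = r @ [(c, v)]"
    using p \<open>p \<noteq> []\<close> by (cases p rule: rev_cases) (auto simp: awalk_Cons_iff awalk_Nil_iff)
  with p have cv: "(c, v) \<in> parcs G"
    by (simp add: awalk_Cons_iff)
  have far1: "(u, v) \<notin> parcs G"
    using far[of "[(u, v)]"] uv by (auto simp: awalk_Cons_iff awalk_Nil_iff)
  \<comment> \<open>A common neighbour of \<open>u\<close> and \<open>v\<close> would give a walk of
    length two.\<close>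
  have far2: "(x, v) \<notin> parcs G" if "(u, x) \<in> parcs G" for x
    using far[of "[(u, x), (x, v)]"] that uv by (auto simp: awalk_Cons_iff awalk_Nil_iff)
  show ?thesis
  proof (rule not_co_chordal_if_induced_two_edges)
    show "pair_graph (jet_graph s G)"
      using assms(1) by (rule pair_graph_jet_graph)
    show "((u, 0), (b, s)) \<in> parcs (jet_graph s G)" "((v, 0), (c, s)) \<in> parcs (jet_graph s G)"
      using ub sym[OF cv] by (auto simp: jet_graph_def)
    \<comment> \<open>Levels allow the first three pairs, so distance excludes them:
      \<open>far1\<close> the first, \<open>far2\<close> at \<open>c\<close> and at \<open>b\<close>
      the next two. The last fails by levels, as \<open>s \<ge> 1\<close>.\<close>
    show "((u, 0), (v, 0)) \<notin> parcs (jet_graph s G)" "((u, 0), (c, s)) \<notin> parcs (jet_graph s G)"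
      "((b, s), (v, 0)) \<notin> parcs (jet_graph s G)" "((b, s), (c, s)) \<notin> parcs (jet_graph s G)"
      using far1 far2 ub cv assms(4) by (auto simp: jet_graph_def)
  qed
qed

end
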